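(* Let $A\in\mathbb{R}^{n\times n}$, $B\in\mathbb{R}^{n\times m}$, $K\in\mathbb{R}^{m\times n}$ be such that $(A,B)$ is stabilizable and $A_{cl}=A-BK$ is Hurwitz. Let $Q\in\mathbb{R}^{n\times n}$ be symmetric positive definite, let $P$ be the unique symmetric positive definite solution of $A_{cl}^\top P+PA_{cl}=-Q$, and let $\sigma\in(0,1)$. Consider the plant $\dot x=Ax+Bu$ with transmission instants $t_k$ generated by the rule that, with $e(t)=x(t)-x(t_k)$, an event is triggered when $\sigma x^\top Px-2x^\top PBKe\le0$. Let $u_{\mathrm{NN}}(x)$ be a control input proposed by a neural network. Accept $u_{\mathrm{NN}}$ only when $$2\,x^\top PB\,(u_{\mathrm{NN}}-u_{\mathrm{safe}})<\sigma\,x^\top Px,$$ where $u_{\mathrm{safe}}=-Kx(t_k)$ is the last certified hold input. If $$\sigma<\frac{\lambda_{\min}(Q)}{2\lambda_{\max}(P)},$$ then the closed-loop system is asymptotically stable regardless of the neural network policy.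
   Context: $\lambda_{\min}(\cdot)$ and $\lambda_{\max}(\cdot)$ denote the smallest and largest eigenvalues of a symmetric matrix. Here $x(t)\in\mathbb{R}^n$ is the state and $u(t)\in\mathbb{R}^m$ the input of the plant; accepting $u_{\mathrm{NN}}$ means applying $u=u_{\mathrm{NN}}$ to the plant, and the acceptance test acts as a gate filtering out unsafe actions. $\{t_k\}_{k=0}^\infty$ is the sequence of transmission instants and $e(t)=x(t)-x(t_k)$, $t\in[t_k,t_{k+1})$, is the sampling-induced error; when an event is triggered, the current state is transmitted and becomes the new held state, so the error resets to zero. Asymptotic stability refers to the origin $x=0$. *)

theory Defs
  imports "HOL-Analysis.Analysis"
begin

definition eigenvalue :: "'a::field^'n^'n \<Rightarrow> 'a \<Rightarrow> bool" where
  "eigenvalue M l \<longleftrightarrow> (\<exists>v. v \<noteq> 0 \<and> M *v v = l *s v)"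

text \<open>The extremal eigenvalues are meant for symmetric matrices, whose real spectrum is finite
  and nonempty.\<close>

definition lambda_min :: "real^'n^'n \<Rightarrow> real" where
  "lambda_min M = (LEAST l. eigenvalue M l)"

definition lambda_max :: "real^'n^'n \<Rightarrow> real" where
  "lambda_max M = (GREATEST l. eigenvalue M l)"

definition hurwitz :: "real^'n^'n \<Rightarrow> bool" where
  "hurwitz M \<longleftrightarrow> (\<forall>l. eigenvalue (map_matrix complex_of_real M) l \<longrightarrow> Re l < 0)"

definition stabilizable :: "real^'n^'n \<Rightarrow> real^'m^'n \<Rightarrow> bool" where
  "stabilizable A B \<longleftrightarrow> (\<exists>F :: real^'n^'m. hurwitz (A - B ** F))"

definition symmetric_pos_def :: "real^'n^'n \<Rightarrow> bool" where
  "symmetric_pos_def M \<longleftrightarrow> transpose M = M \<and> (\<forall>x. x \<noteq> 0 \<longrightarrow> 0 < x \<bullet> (M *v x))"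

definition triggered ::
  "real^'m^'n \<Rightarrow> real^'n^'m \<Rightarrow> real^'n^'n \<Rightarrow> real \<Rightarrow> real^'n \<Rightarrow> real^'n \<Rightarrow> bool" where
  "triggered B K P \<sigma> x e \<longleftrightarrow>
     \<sigma> * (x \<bullet> (P *v x)) - 2 * (x \<bullet> ((P ** B ** K) *v e)) \<le> 0"

definition gate ::
  "real^'m^'n \<Rightarrow> real^'n^'n \<Rightarrow> real \<Rightarrow> real^'n \<Rightarrow> real^'m \<Rightarrow> real^'m \<Rightarrow> bool" where
  "gate B P \<sigma> x u u_safe \<longleftrightarrow>
     2 * (x \<bullet> ((P ** B) *v (u - u_safe))) < \<sigma> * (x \<bullet> (P *v x))"

text \<open>Instant k of the sequence \<open>t\<close> is infinite if fewer than k events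
  occur after time 0. The value \<open>T\<close> (possibly infinite) is the horizon on which the trajectory
  \<open>x\<close> is considered; the hold intervals have to cover \<open>[0, T)\<close>, so Zeno
  behaviour can only happen at the horizon.

  At each event the triggering condition holds for the error relative to the previously held state.
  On a hold interval the condition must not hold, except with error 0. For positive definite \<open>P\<close>
  and positive \<open>\<sigma>\<close> that exception arises only at the origin, where the condition
  holds permanently and resetting the error has no effect; without it no trajectory could stay
  at the origin.\<close>

definition transmission_instants ::
  "real^'m^'n \<Rightarrow> real^'n^'m \<Rightarrow> real^'n^'n \<Rightarrow> real \<Rightarrow> ereal \<Rightarrow> (real \<Rightarrow> real^'n) \<Rightarrow>
   (nat \<Rightarrow> ereal) \<Rightarrow> bool" where
  "transmission_instants B K P \<sigma> T x t \<longleftrightarrow>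
     t 0 = 0 \<and> incseq t \<and> (\<forall>k. t k < T \<longrightarrow> t k < t (Suc k)) \<and> T \<le> (SUP k. t k) \<and>
     (\<forall>k. t (Suc k) < T \<longrightarrow>
        triggered B K P \<sigma> (x (real_of_ereal (t (Suc k))))
          (x (real_of_ereal (t (Suc k))) - x (real_of_ereal (t k)))) \<and>
     (\<forall>k s. t k \<le> ereal s \<and> ereal s < t (Suc k) \<and> ereal s < T \<longrightarrow>
        triggered B K P \<sigma> (x s) (x s - x (real_of_ereal (t k))) \<longrightarrow>
        x s - x (real_of_ereal (t k)) = 0)"

definition gated_input ::
  "real^'m^'n \<Rightarrow> real^'n^'m \<Rightarrow> real^'n^'n \<Rightarrow> real \<Rightarrow> (real^'n \<Rightarrow> real^'m) \<Rightarrow> ereal \<Rightarrow>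
   (real \<Rightarrow> real^'n) \<Rightarrow> (nat \<Rightarrow> ereal) \<Rightarrow> (real \<Rightarrow> real^'m) \<Rightarrow> bool" where
  "gated_input B K P \<sigma> u_NN T x t u \<longleftrightarrow>
     (\<forall>k s. t k \<le> ereal s \<and> ereal s < t (Suc k) \<and> ereal s < T \<longrightarrow>
        (let u_safe = - (K *v x (real_of_ereal (t k)))
         in u s = u_safe \<or> u s = u_NN (x s) \<and> gate B P \<sigma> (x s) (u_NN (x s)) u_safe))"

text \<open>Caratheodory solutions of the plant equation: the input is in general discontinuous.\<close>

definition plant_solution ::
  "real^'n^'n \<Rightarrow> real^'m^'n \<Rightarrow> ereal \<Rightarrow> (real \<Rightarrow> real^'n) \<Rightarrow> (real \<Rightarrow> real^'m) \<Rightarrow> bool" where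
  "plant_solution A B T x u \<longleftrightarrow>
     (\<forall>s. 0 \<le> s \<and> ereal s < T \<longrightarrow>
        (\<lambda>r. A *v x r + B *v u r) absolutely_integrable_on {0..s} \<and>
        ((\<lambda>r. A *v x r + B *v u r) has_integral (x s - x 0)) {0..s})"

definition closed_loop_solution ::
  "real^'n^'n \<Rightarrow> real^'m^'n \<Rightarrow> real^'n^'m \<Rightarrow> real^'n^'n \<Rightarrow> real \<Rightarrow> (real^'n \<Rightarrow> real^'m) \<Rightarrow>
   ereal \<Rightarrow> (real \<Rightarrow> real^'n) \<Rightarrow> bool" where
  "closed_loop_solution A B K P \<sigma> u_NN T x \<longleftrightarrow>
     0 < T \<and>
     (\<exists>t u. transmission_instants B K P \<sigma> T x t \<and> gated_input B K P \<sigma> u_NN T x t u \<and>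
            plant_solution A B T x u)"

text \<open>Asymptotic stability of the origin for a system given by its solutions: \<open>sol T x\<close> says that
  \<open>x\<close> is a solution on \<open>[0, T)\<close>. Solutions need not be unique, and
  all of them are considered; stability also constrains those that exist only on a bounded horizon.\<close>

definition asymptotically_stable ::
  "(ereal \<Rightarrow> (real \<Rightarrow> 'a::real_normed_vector) \<Rightarrow> bool) \<Rightarrow> bool" where
  "asymptotically_stable sol \<longleftrightarrow>
     sol \<infinity> (\<lambda>_. 0) \<and>
     (\<forall>\<epsilon>>0. \<exists>\<delta>>0. \<forall>T x. sol T x \<and> norm (x 0) < \<delta> \<longrightarrow>
        (\<forall>s. 0 \<le> s \<and> ereal s < T \<longrightarrow> norm (x s) < \<epsilon>)) \<and>
     (\<exists>\<delta>>0. \<forall>x. sol \<infinity> x \<and> norm (x 0) < \<delta> \<longrightarrow> (x \<longlongrightarrow> 0) at_top)"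

end

theory Submission
  imports Defs
begin

text \<open>Along a solution the Lyapunov function \<open>V x = x \<bullet> (P *v x)\<close> has the formal derivative
  \<open>- x\<^sup>T Q x + 2 x\<^sup>T P B K e + 2 x\<^sup>T P B (u - u_safe)\<close>. Between events
  the trigger bounds the second term by \<open>\<sigma> V\<close> and the gate bounds the third by
  \<open>\<sigma> V\<close>, whatever the network proposes, so the derivative is at most
  \<open>- c \<parallel>x\<parallel>\<^sup>2\<close> with \<open>c = \<lambda>\<^sub>m\<^sub>i\<^sub>n(Q) - 2 \<sigma> \<lambda>\<^sub>m\<^sub>a\<^sub>x(P) > 0\<close>. Hence
  \<open>V\<close> is nonincreasing, which gives stability, and \<open>c \<integral> \<parallel>x\<parallel>\<^sup>2 \<le> V (x 0)\<close>,
  which for nonincreasing \<open>V\<close> forces \<open>V (x s) = O(1/s)\<close>.\<close>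

section \<open>Extremal eigenvalues of symmetric matrices\<close>

lemma symmetric_inner_commute:
  fixes M :: "real^'n^'n"
  assumes "transpose M = M"
  shows "x \<bullet> (M *v y) = y \<bullet> (M *v x)"
  by (metis assms dot_lmul_matrix inner_commute transpose_matrix_vector)

lemma uminus_matrix_vector_mult:
  fixes M :: "real^'n^'m"
  shows "(- M) *v x = - (M *v x)"
  using matrix_vector_mult_diff_rdistrib[of 0 M x] by simp

text \<open>A minimizer \<open>v\<close> of the quadratic form on the unit sphere is an eigenvector: otherwise
  moving it along \<open>w = M *v v - \<mu> *\<^sub>R v\<close> would decrease the Rayleigh quotient to first
  order.\<close>

lemma symmetric_min_eigenvalue_exists:
  fixes M :: "real^'n^'n"
  assumes sym: "transpose M = M"
  obtains \<mu> where "eigenvalue M \<mu>" "\<And>x. \<mu> * (norm x)\<^sup>2 \<le> x \<bullet> (M *v x)"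
proof -
  have "continuous_on (sphere 0 1) (\<lambda>x. x \<bullet> (M *v x))"
    by (intro continuous_intros linear_continuous_on matrix_vector_mul_bounded_linear)
  moreover have "(sphere 0 1 :: (real^'n) set) \<noteq> {}" by simp
  ultimately obtain v where v: "v \<in> sphere 0 1"
    and min: "\<And>y. y \<in> sphere 0 1 \<Longrightarrow> v \<bullet> (M *v v) \<le> y \<bullet> (M *v y)"
    using continuous_attains_inf[of "sphere 0 1" "\<lambda>x. x \<bullet> (M *v x)"] by auto
  define \<mu> where "\<mu> = v \<bullet> (M *v v)"
  have bound: "\<mu> * (norm x)\<^sup>2 \<le> x \<bullet> (M *v x)" for x
  proof (cases "x = 0")
    case False
    define y where "y = x /\<^sub>R norm x"
    have "y \<in> sphere 0 1" using False by (simp add: y_def)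
    then have "\<mu> \<le> y \<bullet> (M *v y)" using min by (simp add: \<mu>_def)
    also have "y \<bullet> (M *v y) = (x \<bullet> (M *v x)) / (norm x)\<^sup>2"
      by (simp add: y_def matrix_vector_mult_scaleR power2_eq_square divide_simps)
    finally show ?thesis using False by (simp add: field_simps)
  qed simp
  define w where "w = M *v v - \<mu> *\<^sub>R v"
  have vv: "v \<bullet> v = 1" using v by (simp add: dot_square_norm)
  have "w \<bullet> w = 0"
  proof (rule ccontr)
    assume "w \<bullet> w \<noteq> 0"
    then have pos: "w \<bullet> w > 0" using inner_ge_zero[of w] by linarith
    define q where "q = w \<bullet> (M *v w) - \<mu> * (w \<bullet> w)"
    \<comment> \<open>The bound along the line through \<open>v\<close> in direction
      \<open>w\<close>: the constant terms cancel by the choice of \<open>\<mu>\<close>, and the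
      choice of \<open>w\<close> turns the linear coefficient into twice
      \<open>w \<bullet> w\<close>.\<close>
    have *: "0 \<le> 2 * s * (w \<bullet> w) + s\<^sup>2 * q" for s
    proof -
      have "0 \<le> (v + s *\<^sub>R w) \<bullet> (M *v (v + s *\<^sub>R w)) - \<mu> * (norm (v + s *\<^sub>R w))\<^sup>2"
        using bound by simp
      also have "(norm (v + s *\<^sub>R w))\<^sup>2 = 1 + 2 * s * (w \<bullet> v) + s\<^sup>2 * (w \<bullet> w)"
        unfolding power2_norm_eq_inner
        by (simp add: inner_simps vv inner_commute[of v w] algebra_simps power2_eq_square)
      also have "(v + s *\<^sub>R w) \<bullet> (M *v (v + s *\<^sub>R w)) - \<mu> * \<dots>
          = 2 * s * (w \<bullet> (M *v v) - \<mu> * (w \<bullet> v)) + s\<^sup>2 * q"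
        by (simp add: matrix_vector_right_distrib matrix_vector_mult_scaleR inner_simps
            symmetric_inner_commute[OF sym, of v w] q_def \<mu>_def[symmetric]
            algebra_simps power2_eq_square)
      also have "w \<bullet> (M *v v) - \<mu> * (w \<bullet> v) = w \<bullet> w"
        by (simp add: w_def inner_simps)
      finally show ?thesis .
    qed
    have q: "q \<ge> 0" using *[of "1"] *[of "-1"] pos by simp
    \<comment> \<open>The parabola has its minimum at \<open>- (w \<bullet> w) / q\<close>. The
      added 1 avoids any division by zero and still leaves a negative value.\<close>
    define s where "s = - (w \<bullet> w) / (q + 1)"
    have "2 * s * (w \<bullet> w) + s\<^sup>2 * q = - ((w \<bullet> w)\<^sup>2 / (q + 1)\<^sup>2) * (q + 2)"
      using q by (simp add: s_def divide_simps) (simp add: algebra_simps power2_eq_square)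
    moreover have "\<dots> < 0" using pos q by (simp add: mult_less_0_iff)
    ultimately show False using *[of s] by linarith
  qed
  then have "M *v v = \<mu> *s v" by (simp add: w_def scalar_mult_eq_scaleR)
  moreover have "v \<noteq> 0" using vv by auto
  ultimately have "eigenvalue M \<mu>" unfolding eigenvalue_def by blast
  then show ?thesis using bound that by blast
qed

lemma eigenvalue_Rayleigh:
  fixes M :: "real^'n^'n"
  assumes "eigenvalue M l"
  obtains v where "v \<noteq> 0" "v \<bullet> (M *v v) = l * (norm v)\<^sup>2"
proof -
  obtain v where "v \<noteq> 0" "M *v v = l *s v" using assms by (auto simp: eigenvalue_def)
  then show ?thesis
    by (intro that[of v]) (auto simp: scalar_mult_eq_scaleR power2_norm_eq_inner)
qed

lemma eigenvalue_uminus: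
  fixes M :: "real^'n^'n"
  shows "eigenvalue (- M) l \<longleftrightarrow> eigenvalue M (- l)"
proof -
  have "(- M) *v v = l *s v \<longleftrightarrow> M *v v = (- l) *s v" for v
    by (auto simp: uminus_matrix_vector_mult scalar_mult_eq_scaleR minus_equation_iff[of "M *v v"])
  then show ?thesis by (simp add: eigenvalue_def)
qed

text \<open>\<open>LEAST\<close> over the reals means something only if the minimum is attained. The
  eigenvalue that bounds the quadratic form is that minimum, as evaluating the bound at an
  eigenvector of any other eigenvalue shows.\<close>

lemma
  fixes M :: "real^'n^'n"
  assumes "transpose M = M"
  shows eigenvalue_lambda_min: "eigenvalue M (lambda_min M)"
    and lambda_min_le_quadratic_form: "lambda_min M * (norm x)\<^sup>2 \<le> x \<bullet> (M *v x)"
proof -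
  obtain \<mu> where \<mu>: "eigenvalue M \<mu>" "\<And>x. \<mu> * (norm x)\<^sup>2 \<le> x \<bullet> (M *v x)"
    using symmetric_min_eigenvalue_exists[OF assms] by blast
  have "\<mu> \<le> l" if "eigenvalue M l" for l
    using eigenvalue_Rayleigh[OF that] \<mu>(2) by (metis mult_le_cancel_right_pos zero_less_norm_iff zero_less_power)
  then have "lambda_min M = \<mu>"
    unfolding lambda_min_def using \<mu>(1) by (intro Least_equality)
  then show "eigenvalue M (lambda_min M)" "lambda_min M * (norm x)\<^sup>2 \<le> x \<bullet> (M *v x)"
    using \<mu> by auto
qed

text \<open>Negation reverses the order of the spectrum, so the existence of the greatest eigenvalue
  and its quadratic bound follow from the facts about the least one.\<close>

lemma lambda_max_eq_uminus_lambda_min: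
  fixes M :: "real^'n^'n"
  assumes "transpose M = M"
  shows "lambda_max M = - lambda_min (- M)"
  unfolding lambda_max_def
proof (rule Greatest_equality)
  have sym: "transpose (- M) = - M"
    using assms by (simp add: vec_eq_iff transpose_def)
  show "eigenvalue M (- lambda_min (- M))"
    using eigenvalue_lambda_min[OF sym] by (simp add: eigenvalue_uminus)
  fix l assume "eigenvalue M l"
  then have "eigenvalue (- M) (- l)" by (simp add: eigenvalue_uminus)
  then obtain v where v: "v \<noteq> 0" "v \<bullet> (- M *v v) = - l * (norm v)\<^sup>2"
    using eigenvalue_Rayleigh by blast
  have "lambda_min (- M) * (norm v)\<^sup>2 \<le> - l * (norm v)\<^sup>2"
    using lambda_min_le_quadratic_form[OF sym, of v] v by simp
  then have "lambda_min (- M) \<le> - l"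
    by (rule mult_right_le_imp_le) (use v(1) in simp)
  then show "l \<le> - lambda_min (- M)" by simp
qed

lemma quadratic_form_le_lambda_max:
  fixes M :: "real^'n^'n"
  assumes "transpose M = M"
  shows "x \<bullet> (M *v x) \<le> lambda_max M * (norm x)\<^sup>2"
proof -
  have sym: "transpose (- M) = - M"
    using assms by (simp add: vec_eq_iff transpose_def)
  show ?thesis
    using lambda_min_le_quadratic_form[OF sym, of x] lambda_max_eq_uminus_lambda_min[OF assms]
    by (simp add: uminus_matrix_vector_mult)
qed

lemma lambda_min_pos:
  assumes "symmetric_pos_def M"
  shows "0 < lambda_min M"
proof -
  have "eigenvalue M (lambda_min M)"
    using assms by (simp add: symmetric_pos_def_def eigenvalue_lambda_min)
  then obtain v where "v \<noteq> 0" "v \<bullet> (M *v v) = lambda_min M * (norm v)\<^sup>2"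
    using eigenvalue_Rayleigh by blast
  then show ?thesis
    using assms unfolding symmetric_pos_def_def
    by (metis zero_less_mult_pos2 zero_less_norm_iff zero_less_power)
qed

lemma lambda_max_pos:
  fixes M :: "real^'n^'n"
  assumes "symmetric_pos_def M"
  shows "0 < lambda_max M"
proof -
  obtain v :: "real^'n" where "v \<noteq> 0"
    using vector_choose_size[of 1] by (metis norm_zero zero_neq_one zero_le_one)
  then have "0 < lambda_max M * (norm v)\<^sup>2"
    using assms quadratic_form_le_lambda_max[of M v] unfolding symmetric_pos_def_def
    by (meson less_le_trans)
  then show ?thesis by (simp add: zero_less_mult_iff)
qed

section \<open>Quadratic forms along absolutely continuous curves\<close>

text \<open>Cutting the interval into \<open>N\<close> equal steps shorter than \<open>d\<close>
  chains the local inequalities. This lets an estimate that relies on uniform continuity be proved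
  on short intervals only.\<close>

lemma locally_nonincreasing_imp_le:
  fixes W :: "real \<Rightarrow> real"
  assumes "a \<le> b" "0 < d"
    and step: "\<And>u v. a \<le> u \<Longrightarrow> u \<le> v \<Longrightarrow> v \<le> b \<Longrightarrow> v - u < d \<Longrightarrow> W v \<le> W u"
  shows "W b \<le> W a"
proof -
  obtain N :: nat where N: "(b - a) / d < real N" using reals_Archimedean2 by blast
  then have N0: "0 < real N" using assms(1,2) by (meson divide_nonneg_pos diff_ge_0_iff_ge le_less_trans)
  define h where "h = (b - a) / real N"
  have h: "0 \<le> h" "h < d" "real N * h = b - a"
    using assms N N0 by (auto simp: h_def field_simps)
  have "i \<le> N \<Longrightarrow> W (a + real i * h) \<le> W a" for i
  proof (induction i)
    case (Suc i)
    have "real (Suc i) * h \<le> real N * h" using Suc.prems h(1) by (intro mult_right_mono) auto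
    moreover have "0 \<le> real i * h" using h(1) by simp
    ultimately have "W (a + real (Suc i) * h) \<le> W (a + real i * h)"
      using h by (intro step) (auto simp: algebra_simps)
    with Suc show ?case by simp
  qed simp
  from this[of N] show ?thesis using h(3) by simp
qed

text \<open>No differentiability of \<open>x\<close> is used: on a short interval
  \<open>V(x v) - V(x u) = \<integral> f \<bullet> P (x u + x v)\<close>, and \<open>x u + x v\<close> is uniformly close to
  \<open>2 x r\<close>, at the cost of a small multiple of \<open>\<integral> \<parallel>f\<parallel>\<close>.\<close>

lemma quadratic_form_diff_le_integral:
  fixes P :: "real^'n^'n" and x f :: "real \<Rightarrow> real^'n"
  assumes sym: "transpose P = P" and ab: "a \<le> b"
    and abs_int: "f absolutely_integrable_on {a..b}"
    and int: "\<And>u v. a \<le> u \<Longrightarrow> u \<le> v \<Longrightarrow> v \<le> b \<Longrightarrow> (f has_integral (x v - x u)) {u..v}"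
    and cont: "continuous_on {a..b} x"
    and g: "g integrable_on {a..b}"
    and le: "\<And>r. r \<in> {a..b} \<Longrightarrow> 2 * (f r \<bullet> (P *v x r)) \<le> g r"
  shows "x b \<bullet> (P *v x b) - x a \<bullet> (P *v x a) \<le> integral {a..b} g"
proof (rule field_le_epsilon)
  fix e :: real assume e: "0 < e"
  define F where "F = integral {a..b} (\<lambda>r. norm (f r))"
  have nf: "(\<lambda>r. norm (f r)) integrable_on {a..b}"
    using abs_int by (simp add: absolutely_integrable_on_def)
  have F: "0 \<le> F" unfolding F_def by (intro integral_nonneg nf) auto
  obtain C where C: "C > 0" "\<And>y. norm (P *v y) \<le> norm y * C"
    using bounded_linear.pos_bounded[OF matrix_vector_mul_bounded_linear[of P]] by blast
  \<comment> \<open>The total error will be \<open>\<eta> * F\<close>, which must stay below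
    \<open>e\<close>; the added 1 covers \<open>F = 0\<close>.\<close>
  define \<eta> where "\<eta> = e / (F + 1)"
  have \<eta>: "0 < \<eta>" "\<eta> * F \<le> e" using e F by (auto simp: \<eta>_def field_simps)
  have "uniformly_continuous_on {a..b} x"
    by (simp add: compact_uniformly_continuous cont)
  then obtain d where d: "0 < d"
    "\<And>r s. r \<in> {a..b} \<Longrightarrow> s \<in> {a..b} \<Longrightarrow> dist s r < d \<Longrightarrow> dist (x s) (x r) < \<eta> / (2 * C)"
    using \<eta> C unfolding uniformly_continuous_on_def
    by (metis divide_pos_pos mult_pos_pos zero_less_numeral)
  \<comment> \<open>The quadratic form minus the claimed bound and the error allowance up to time
    \<open>s\<close>. Both integrals vanish at \<open>a\<close>, so \<open>W b \<le> W a\<close> is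
    the claim up to \<open>e\<close>.\<close>
  define W where "W s = x s \<bullet> (P *v x s) - integral {a..s} g
      - \<eta> * integral {a..s} (\<lambda>r. norm (f r))" for s
  have "W b \<le> W a"
  proof (rule locally_nonincreasing_imp_le[OF ab d(1)])
    fix u v assume uv: "a \<le> u" "u \<le> v" "v \<le> b" "v - u < d"
    have sub: "{u..v} \<subseteq> {a..b}" using uv by auto
    have gi: "g integrable_on {u..v}" and ni: "(\<lambda>r. norm (f r)) integrable_on {u..v}"
      using integrable_subinterval_real[OF _ sub] g nf by auto
    have split: "integral {a..v} h = integral {a..u} h + integral {u..v} h"
      if "h integrable_on {a..b}" for h :: "real \<Rightarrow> real"
    proof -
      have "h integrable_on {a..v}"
        by (rule integrable_subinterval_real[OF that]) (use uv in auto)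
      then show ?thesis using Henstock_Kurzweil_Integration.integral_combine[of a u v h] uv by simp
    qed
    have hi: "((\<lambda>r. f r \<bullet> (P *v (x u + x v))) has_integral (x v - x u) \<bullet> (P *v (x u + x v))) {u..v}"
      using has_integral_linear[OF int[OF uv(1,2,3)] bounded_linear_inner_left]
      by (simp add: o_def)
    \<comment> \<open>A difference of squares: symmetry of \<open>P\<close> cancels the cross terms,
      leaving one factor that is the integral of \<open>f\<close>.\<close>
    have "x v \<bullet> (P *v x v) - x u \<bullet> (P *v x u) = (x v - x u) \<bullet> (P *v (x u + x v))"
      by (simp add: matrix_vector_right_distrib inner_simps symmetric_inner_commute[OF sym, of "x v" "x u"])
    also have "\<dots> \<le> integral {u..v} (\<lambda>r. g r + \<eta> * norm (f r))"
    proof (rule has_integral_le[OF hi])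
      show "((\<lambda>r. g r + \<eta> * norm (f r)) has_integral integral {u..v} (\<lambda>r. g r + \<eta> * norm (f r))) {u..v}"
        using gi ni by (intro integrable_integral integrable_add integrable_on_mult_right)
      fix r assume r: "r \<in> {u..v}"
      have "dist (x u) (x r) < \<eta> / (2 * C)" "dist (x v) (x r) < \<eta> / (2 * C)"
        using r uv by (auto intro!: d(2) simp: dist_real_def)
      then have "norm ((x u - x r) + (x v - x r)) \<le> \<eta> / (2 * C) + \<eta> / (2 * C)"
        by (intro norm_triangle_le) (simp add: dist_norm)
      \<comment> \<open>Two deviations below \<open>\<eta> / (2 * C)\<close> add up to at most
        \<open>\<eta> / C\<close>, and \<open>P\<close> enlarges norms by a factor of at most
        \<open>C\<close>.\<close>
      then have "norm (P *v ((x u - x r) + (x v - x r))) \<le> \<eta>"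
        using C(1) order_trans[OF C(2), of "(x u - x r) + (x v - x r)" \<eta>]
        by (simp add: field_simps)
      then have "f r \<bullet> (P *v ((x u - x r) + (x v - x r))) \<le> norm (f r) * \<eta>"
        by (meson norm_cauchy_schwarz mult_left_mono norm_ge_zero order_trans)
      moreover have "x u + x v = x r + x r + ((x u - x r) + (x v - x r))" by simp
      then have "f r \<bullet> (P *v (x u + x v))
          = 2 * (f r \<bullet> (P *v x r)) + f r \<bullet> (P *v ((x u - x r) + (x v - x r)))"
        by (metis inner_add_right matrix_vector_right_distrib mult_2)
      ultimately show "f r \<bullet> (P *v (x u + x v)) \<le> g r + \<eta> * norm (f r)"
        using le[of r] r sub by (auto simp: mult.commute)
    qed
    also have "\<dots> = integral {u..v} g + \<eta> * integral {u..v} (\<lambda>r. norm (f r))"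
      using gi ni by (simp add: Henstock_Kurzweil_Integration.integral_add integrable_on_mult_right)
    finally show "W v \<le> W u"
      by (simp add: W_def split[OF g] split[OF nf] algebra_simps)
  qed
  then show "x b \<bullet> (P *v x b) - x a \<bullet> (P *v x a) \<le> integral {a..b} g + e"
    using \<eta>(2) by (simp add: W_def F_def)
qed

section \<open>The closed loop\<close>

text \<open>The first instant beyond \<open>s\<close> exists because the supremum is at least
  \<open>T\<close>, and it is not instant 0; its predecessor starts the hold interval.\<close>

lemma transmission_instants_cover:
  assumes "transmission_instants B K P \<sigma> T x t" "0 \<le> s" "ereal s < T"
  obtains k where "t k \<le> ereal s" "ereal s < t (Suc k)"
proof -
  have t: "t 0 = 0" "T \<le> (SUP k. t k)"
    using assms(1) by (auto simp: transmission_instants_def)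
  then have "ereal s < (SUP k. t k)" using assms(3) by simp
  then obtain j where "ereal s < t j" by (auto simp: less_SUP_iff)
  moreover define n where "n = (LEAST j. ereal s < t j)"
  ultimately have n: "ereal s < t n" "\<And>m. m < n \<Longrightarrow> t m \<le> ereal s"
    by (auto intro: LeastI dest: not_less_Least simp: not_less)
  have "n \<noteq> 0" using n(1) t(1) assms(2) by (intro notI) simp
  then show ?thesis using that[of "n - 1"] n by simp
qed

text \<open>Here \<open>z\<close> is the held state and \<open>v\<close> the current input.\<close>

lemma gated_decrease:
  fixes A :: "real^'n^'n" and B :: "real^'m^'n" and K :: "real^'n^'m" and P Q :: "real^'n^'n"
  assumes symP: "symmetric_pos_def P" and symQ: "symmetric_pos_def Q"
    and lyap: "transpose (A - B ** K) ** P + P ** (A - B ** K) = - Q"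
    and \<sigma>: "0 < \<sigma>"
    and trig: "triggered B K P \<sigma> y (y - z) \<longrightarrow> y - z = 0"
    and gate: "v = - (K *v z) \<or> gate B P \<sigma> y v (- (K *v z))"
  shows "2 * ((A *v y + B *v v) \<bullet> (P *v y))
    \<le> - (lambda_min Q - 2 * \<sigma> * lambda_max P) * (norm y)\<^sup>2"
proof -
  let ?V = "y \<bullet> (P *v y)" and ?M = "A - B ** K"
  have sP: "transpose P = P" and sQ: "transpose Q = Q"
    using symP symQ by (auto simp: symmetric_pos_def_def)
  have V0: "0 \<le> \<sigma> * ?V"
    using symP \<sigma> by (cases "y = 0") (auto simp: symmetric_pos_def_def less_imp_le)
  have err: "2 * (y \<bullet> ((P ** B ** K) *v (y - z))) \<le> \<sigma> * ?V"
  proof (cases "y - z = 0")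
    case True
    then show ?thesis using V0 by simp
  next
    case False
    then show ?thesis using trig by (simp add: triggered_def)
  qed
  have inp: "2 * (y \<bullet> ((P ** B) *v (v + K *v z))) \<le> \<sigma> * ?V"
    using gate V0 by (auto simp: gate_def)
  \<comment> \<open>The velocity splits into the nominal closed loop, the sampling error, bounded
    through the trigger, and the deviation from the hold input, bounded through the gate.\<close>
  have "A *v y + B *v v = ?M *v y + (B ** K) *v (y - z) + B *v (v + K *v z)"
    by (simp add: matrix_vector_mult_diff_rdistrib matrix_vector_mult_diff_distrib
        matrix_vector_right_distrib matrix_vector_mul_assoc)
  then have "(A *v y + B *v v) \<bullet> (P *v y)
    = y \<bullet> (P *v (?M *v y)) + y \<bullet> ((P ** B ** K) *v (y - z)) + y \<bullet> ((P ** B) *v (v + K *v z))"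
    by (simp add: symmetric_inner_commute[OF sP, of _ y] matrix_vector_right_distrib
        inner_add_right matrix_vector_mul_assoc matrix_mul_assoc)
  moreover have "2 * (y \<bullet> (P *v (?M *v y))) = - (y \<bullet> (Q *v y))"
  proof -
    have "- (y \<bullet> (Q *v y)) = y \<bullet> ((transpose ?M ** P + P ** ?M) *v y)"
      by (simp add: lyap uminus_matrix_vector_mult)
    also have "\<dots> = y \<bullet> (transpose ?M *v (P *v y)) + y \<bullet> (P *v (?M *v y))"
      by (simp add: matrix_vector_mult_add_rdistrib inner_add_right matrix_vector_mul_assoc)
    also have "y \<bullet> (transpose ?M *v (P *v y)) = (?M *v y) \<bullet> (P *v y)"
      by (metis dot_lmul_matrix inner_commute transpose_matrix_vector)
    also have "\<dots> = y \<bullet> (P *v (?M *v y))" by (rule symmetric_inner_commute[OF sP])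
    finally show ?thesis by simp
  qed
  ultimately have "2 * ((A *v y + B *v v) \<bullet> (P *v y)) \<le> - (y \<bullet> (Q *v y)) + 2 * (\<sigma> * ?V)"
    using err inp by simp
  also have "\<dots> \<le> - (lambda_min Q * (norm y)\<^sup>2) + 2 * (\<sigma> * (lambda_max P * (norm y)\<^sup>2))"
    using lambda_min_le_quadratic_form[OF sQ, of y] quadratic_form_le_lambda_max[OF sP, of y] \<sigma>
    by (intro add_mono) auto
  finally show ?thesis by (simp add: algebra_simps)
qed

lemma closed_loop_dissipation:
  fixes A :: "real^'n^'n" and B :: "real^'m^'n" and K :: "real^'n^'m" and P Q :: "real^'n^'n"
  assumes symP: "symmetric_pos_def P" and symQ: "symmetric_pos_def Q"
    and lyap: "transpose (A - B ** K) ** P + P ** (A - B ** K) = - Q"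
    and \<sigma>: "0 < \<sigma>"
    and sol: "closed_loop_solution A B K P \<sigma> u_NN T x"
    and ab: "0 \<le> a" "a \<le> b" "ereal b < T"
  shows "(\<lambda>r. (norm (x r))\<^sup>2) integrable_on {a..b}"
    and "x b \<bullet> (P *v x b) - x a \<bullet> (P *v x a)
      \<le> - (lambda_min Q - 2 * \<sigma> * lambda_max P) * integral {a..b} (\<lambda>r. (norm (x r))\<^sup>2)"
proof -
  let ?c = "lambda_min Q - 2 * \<sigma> * lambda_max P"
  obtain t u where tr: "transmission_instants B K P \<sigma> T x t"
    and gi: "gated_input B K P \<sigma> u_NN T x t u" and pl: "plant_solution A B T x u"
    using sol by (auto simp: closed_loop_solution_def)
  define f where "f r = A *v x r + B *v u r" for r
  have f: "f absolutely_integrable_on {0..s}" "(f has_integral (x s - x 0)) {0..s}"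
    if "0 \<le> s" "s \<le> b" for s
  proof -
    have "ereal s < T" using that(2) ab(3) by (meson ereal_less_eq(3) le_less_trans)
    then show "f absolutely_integrable_on {0..s}" "(f has_integral (x s - x 0)) {0..s}"
      using pl that(1) unfolding plant_solution_def f_def by auto
  qed
  have int: "(f has_integral (x v - x w)) {w..v}" if "0 \<le> w" "w \<le> v" "v \<le> b" for w v
  proof -
    have fv: "f integrable_on {0..v}" using f(2)[of v] that by auto
    then have "integral {0..w} f + integral {w..v} f = integral {0..v} f"
      using that by (intro Henstock_Kurzweil_Integration.integral_combine)
    then have "integral {w..v} f = x v - x w"
      using f(2)[of v] f(2)[of w] that by (simp add: integral_unique algebra_simps)
    moreover have "f integrable_on {w..v}"
      by (rule integrable_subinterval_real[OF fv]) (use that in auto)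
    ultimately show ?thesis by (metis integrable_integral)
  qed
  \<comment> \<open>Continuity of the state is not part of the solution concept; it comes from being
    an indefinite integral.\<close>
  have "continuous_on {0..b} (\<lambda>s. x 0 + integral {0..s} f)"
    using f(2)[of b] ab by (intro continuous_intros indefinite_integral_continuous_1) auto
  moreover have "x 0 + integral {0..s} f = x s" if "s \<in> {0..b}" for s
    using f(2)[of s] that by (simp add: integral_unique)
  ultimately have "continuous_on {0..b} x" by (rule continuous_on_eq)
  then have cont: "continuous_on {a..b} x"
    by (rule continuous_on_subset) (use ab in auto)
  then show ni: "(\<lambda>r. (norm (x r))\<^sup>2) integrable_on {a..b}"
    by (intro integrable_continuous_interval continuous_intros)
  have "x b \<bullet> (P *v x b) - x a \<bullet> (P *v x a) \<le> integral {a..b} (\<lambda>r. - ?c * (norm (x r))\<^sup>2)"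
  proof (rule quadratic_form_diff_le_integral[where f = f])
    show "transpose P = P" using symP by (simp add: symmetric_pos_def_def)
    show "f absolutely_integrable_on {a..b}"
      by (rule absolutely_integrable_on_subinterval[OF f(1)[of b]]) (use ab in auto)
    show "(f has_integral (x v - x w)) {w..v}" if "a \<le> w" "w \<le> v" "v \<le> b" for w v
      using int[of w v] that ab by simp
    show "(\<lambda>r. - ?c * (norm (x r))\<^sup>2) integrable_on {a..b}"
      using ni by (rule integrable_on_mult_right)
    fix r assume r: "r \<in> {a..b}"
    have r0: "0 \<le> r" using r ab(1) by simp
    have rT: "ereal r < T" using r ab(3)
      by (metis atLeastAtMost_iff ereal_less_eq(3) le_less_trans)
    obtain k where k: "t k \<le> ereal r" "ereal r < t (Suc k)"
      using transmission_instants_cover[OF tr r0 rT] by blast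
    let ?z = "x (real_of_ereal (t k))"
    have "triggered B K P \<sigma> (x r) (x r - ?z) \<longrightarrow> x r - ?z = 0"
      using tr k rT by (auto simp: transmission_instants_def)
    \<comment> \<open>An accepted proposal is the applied input itself, so only its gate inequality
      is kept and the policy disappears from the argument.\<close>
    moreover have "u r = - (K *v ?z) \<or> gate B P \<sigma> (x r) (u r) (- (K *v ?z))"
      using gi k rT unfolding gated_input_def Let_def by metis
    ultimately show "2 * (f r \<bullet> (P *v x r)) \<le> - ?c * (norm (x r))\<^sup>2"
      unfolding f_def by (intro gated_decrease[OF symP symQ lyap \<sigma>])
  qed (use ab cont in auto)
  then show "x b \<bullet> (P *v x b) - x a \<bullet> (P *v x a)
      \<le> - ?c * integral {a..b} (\<lambda>r. (norm (x r))\<^sup>2)"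
    by simp
qed

text \<open>At the origin every instant may count as an event, so any strictly increasing unbounded
  sequence starting at 0 serves. The applied input is the hold input, which is zero whatever the
  network proposes there.\<close>

lemma closed_loop_solution_zero:
  "closed_loop_solution A B K P \<sigma> u_NN \<infinity> (\<lambda>_. 0)"
proof -
  have "(SUP k. ereal (real k)) = \<infinity>"
    by (rule SUP_PInfty) auto
  then have "transmission_instants B K P \<sigma> \<infinity> (\<lambda>_. 0) (\<lambda>k. ereal (real k))"
    by (simp add: transmission_instants_def triggered_def incseq_def)
  moreover have "gated_input B K P \<sigma> u_NN \<infinity> (\<lambda>_. 0) (\<lambda>k. ereal (real k)) (\<lambda>_. 0)"
    by (simp add: gated_input_def Let_def)
  moreover have "plant_solution A B \<infinity> (\<lambda>_. 0) (\<lambda>_. 0)"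
    by (simp add: plant_solution_def)
  ultimately show ?thesis unfolding closed_loop_solution_def by auto
qed

theorem theorem3:
  fixes A :: "real^'n^'n" and B :: "real^'m^'n" and K :: "real^'n^'m"
    and Q P :: "real^'n^'n" and \<sigma> :: real
    and u_NN :: "real^'n \<Rightarrow> real^'m"
  assumes "stabilizable A B"
    and "hurwitz (A - B ** K)"
    and "symmetric_pos_def Q"
    and "symmetric_pos_def P"
    and "transpose (A - B ** K) ** P + P ** (A - B ** K) = - Q"
    and "0 < \<sigma>" and "\<sigma> < 1"
    and "\<sigma> < lambda_min Q / (2 * lambda_max P)"
  shows "asymptotically_stable (closed_loop_solution A B K P \<sigma> u_NN)"
proof -
  let ?sol = "closed_loop_solution A B K P \<sigma> u_NN"
  define c where "c = lambda_min Q - 2 * \<sigma> * lambda_max P"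
  define l where "l = lambda_min P"
  define L where "L = lambda_max P"
  define V where "V y = y \<bullet> (P *v y)" for y
  have sP: "transpose P = P" using assms(4) by (simp add: symmetric_pos_def_def)
  have l: "0 < l" and L: "0 < L"
    using assms(4) by (auto simp: l_def L_def lambda_min_pos lambda_max_pos)
  \<comment> \<open>The bound on \<open>\<sigma>\<close> is exactly positivity of the decay rate:
    the factor 2 pays once for the trigger and once for the gate.\<close>
  have c: "0 < c" using assms(8) L by (simp add: c_def L_def field_simps)
  have lV: "l * (norm y)\<^sup>2 \<le> V y" and VL: "V y \<le> L * (norm y)\<^sup>2" for y
    unfolding l_def L_def V_def
    by (auto intro: lambda_min_le_quadratic_form quadratic_form_le_lambda_max sP)
  have V0: "0 \<le> V y" for y using lV[of y] l by (meson less_imp_le mult_nonneg_nonneg order_trans zero_le_power2)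
  have dis: "V (x b) - V (x a) \<le> - c * integral {a..b} (\<lambda>r. (norm (x r))\<^sup>2)"
    "(\<lambda>r. (norm (x r))\<^sup>2) integrable_on {a..b}"
    if "?sol T x" "0 \<le> a" "a \<le> b" "ereal b < T" for T x a b
    using closed_loop_dissipation[OF assms(4,3,5,6) that] by (auto simp: V_def c_def)
  have mono: "V (x b) \<le> V (x a)"
    if "?sol T x" "0 \<le> a" "a \<le> b" "ereal b < T" for T x a b
  proof -
    have "0 \<le> c * integral {a..b} (\<lambda>r. (norm (x r))\<^sup>2)"
      using dis(2)[OF that] c by (intro mult_nonneg_nonneg integral_nonneg) auto
    then show ?thesis using dis(1)[OF that] by simp
  qed
  have stable: "\<exists>\<delta>>0. \<forall>T x. ?sol T x \<and> norm (x 0) < \<delta> \<longrightarrow>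
        (\<forall>s. 0 \<le> s \<and> ereal s < T \<longrightarrow> norm (x s) < \<epsilon>)" if \<epsilon>: "0 < \<epsilon>" for \<epsilon>
  \<comment> \<open>The radius comes from comparing \<open>l * (norm (x s))\<^sup>2\<close> with
    \<open>L * (norm (x 0))\<^sup>2\<close>: the norm can grow by a factor of at most
    \<open>sqrt (L / l)\<close>.\<close>
  proof (intro exI[of _ "\<epsilon> * sqrt (l / L)"] conjI allI impI; (elim conjE)?)
    show "0 < \<epsilon> * sqrt (l / L)" using \<epsilon> l L by simp
    fix T x s assume x: "?sol T x" "norm (x 0) < \<epsilon> * sqrt (l / L)" "0 \<le> s" "ereal s < T"
    have "l * (norm (x s))\<^sup>2 \<le> V (x 0)"
      using lV[of "x s"] mono[OF x(1) order_refl x(3,4)] by simp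
    also have "\<dots> \<le> L * (norm (x 0))\<^sup>2" by (rule VL)
    also have "\<dots> < L * (\<epsilon> * sqrt (l / L))\<^sup>2"
      using x(2) L by (intro mult_strict_left_mono power_strict_mono) auto
    also have "\<dots> = l * \<epsilon>\<^sup>2" using l L by (simp add: power_mult_distrib)
    finally have "(norm (x s))\<^sup>2 < \<epsilon>\<^sup>2" using l by simp
    then show "norm (x s) < \<epsilon>" using \<epsilon> by (simp add: power2_less_imp_less)
  qed
  have attractive: "(x \<longlongrightarrow> 0) at_top" if x: "?sol \<infinity> x" for x
  proof -
    have bound: "(norm (x s))\<^sup>2 \<le> (L * V (x 0) / (c * l)) / s" if s: "0 < s" for s
    proof -
      \<comment> \<open>Since \<open>V\<close> does not increase, its final value divided by
        \<open>L\<close> bounds the squared norm from below on all of \<open>{0..s}\<close>; the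
        dissipated energy then limits that value by a multiple of \<open>1 / s\<close>.\<close>
      have "s * (V (x s) / L) = integral {0..s} (\<lambda>r. V (x s) / L)" using s by simp
      also have "\<dots> \<le> integral {0..s} (\<lambda>r. (norm (x r))\<^sup>2)"
      proof (rule integral_le)
        show "(\<lambda>r. (norm (x r))\<^sup>2) integrable_on {0..s}" using dis(2)[OF x, of 0 s] s by simp
        fix r assume "r \<in> {0..s}"
        then have "V (x s) \<le> L * (norm (x r))\<^sup>2"
          using mono[OF x, of r s] VL[of "x r"] by simp
        then show "V (x s) / L \<le> (norm (x r))\<^sup>2" using L by (simp add: field_simps)
      qed (rule integrable_const_ivl)
      finally have "c * (s * (V (x s) / L)) \<le> c * integral {0..s} (\<lambda>r. (norm (x r))\<^sup>2)"
        using c by (intro mult_left_mono) auto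
      also have "\<dots> \<le> V (x 0)"
        using dis(1)[OF x, of 0 s] s V0[of "x s"] by simp
      finally have *: "c * s * V (x s) \<le> L * V (x 0)" using L by (simp add: field_simps)
      have "c * s * (l * (norm (x s))\<^sup>2) \<le> c * s * V (x s)"
        using lV[of "x s"] c s by (intro mult_left_mono) auto
      from order_trans[OF this *] show ?thesis using c s l by (simp add: field_simps)
    qed
    have "((\<lambda>s. (L * V (x 0) / (c * l)) / s) \<longlongrightarrow> 0) at_top"
      by (intro tendsto_divide_0[OF tendsto_const] filterlim_at_top_imp_at_infinity filterlim_ident)
    then have "((\<lambda>s. (norm (x s))\<^sup>2) \<longlongrightarrow> 0) at_top"
    proof (rule tendsto_sandwich[rotated 3])
      show "\<forall>\<^sub>F s in at_top. (norm (x s))\<^sup>2 \<le> (L * V (x 0) / (c * l)) / s"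
        using eventually_gt_at_top[of 0] by eventually_elim (rule bound)
    qed auto
    then have "((\<lambda>s. sqrt ((norm (x s))\<^sup>2)) \<longlongrightarrow> sqrt 0) at_top" by (rule tendsto_real_sqrt)
    then show ?thesis by (simp add: tendsto_norm_zero_iff)
  qed
  show ?thesis
    unfolding asymptotically_stable_def
    \<comment> \<open>Attraction was shown from every initial state, so the radius 1 is
      arbitrary.\<close>
    using closed_loop_solution_zero stable attractive by (auto intro: exI[of _ 1])
qed

end
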